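(* Let $F_t=\{t f_i(x)+q_i : 1\le i\le N\}$, $t\ge 0$, be a one-parameter affine family on $\mathbb{R}^d$, with $F=\{f_1,\dots,f_N\}$. Then an attractor $A_t$ of $F_t$ exists for $t<1/\rho(F)$ and fails to exist for $t\ge 1/\rho(F)$. In other words, the threshold for the existence of the attractor is $t_0=1/\rho(F)$.
   Context: A function $f:\mathbb{R}^d\to\mathbb{R}^d$ is affine if $f(x)=Lx+a$, where $L$ is a non-singular $d\times d$ real matrix (the linear part of $f$) and $a\in\mathbb{R}^d$. A one-parameter affine family is given by $N\ge 2$ affine functions $F=\{f_1,\dots,f_N\}$ on $\mathbb{R}^d$ and vectors $q_1,\dots,q_N\in\mathbb{R}^d$; for each real $t\ge 0$ it is $F_t=\{t f_i(x)+q_i : 1\le i\le N\}$. The Hutchinson operator of $F_t$ on non-empty compact sets is $F_t(K)=\bigcup_{f\in F_t} f(K)$. A non-empty compact set $A$ is the attractor of $F_t$ if $A=\lim_{k\to\infty}F_t^k(K)$ in the Hausdorff metric for every non-empty compact $K\subset\mathbb{R}^d$ ($F_t^k$ is the $k$-fold composition). If $L_1,\dots,L_N$ are the linear parts of $f_1,\dots,f_N$, the joint spectral radius of $F$ is $\rho(F)=\limsup_{k\to\infty}\big(\max\|L_{i_1}L_{i_2}\cdots L_{i_k}\|\big)^{1/k}$, the maximum being over all words $i_1 i_2\cdots i_k$ with $i_j\in\{1,\dots,N\}$ (independent of the matrix norm). *)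

theory Defs
  imports "HOL-Analysis.Analysis"
begin

definition affine_function :: "(real^'n \<Rightarrow> real^'n) \<Rightarrow> bool" where
  "affine_function f \<longleftrightarrow> (\<exists>L a. invertible L \<and> (\<forall>x. f x = L *v x + a))"

definition linear_part :: "(real^'n \<Rightarrow> real^'n) \<Rightarrow> real^'n^'n" where
  "linear_part f = (THE L. \<exists>a. \<forall>x. f x = L *v x + a)"

lemma linear_part_eq:
  fixes L :: "real^'n^'n"
  assumes "\<And>x. f x = L *v x + a"
  shows "linear_part f = L"
  unfolding linear_part_def
proof (rule the_equality)
  show "\<exists>a. \<forall>x. f x = L *v x + a"
    using assms by blast
next
  fix M :: "real^'n^'n"
  assume "\<exists>b. \<forall>x. f x = M *v x + b"
  then obtain b where b: "\<And>x. f x = M *v x + b"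
    by blast
  have "a = b"
    using assms[of 0] b[of 0] by simp
  then have "M *v x = L *v x" for x
    using assms[of x] b[of x] by simp
  then show "M = L"
    by (simp add: matrix_eq)
qed

text \<open>A word in the linear parts is a list of matrices and its value is the matrix product in
  order; \<^term>\<open>prod_list\<close> would multiply componentwise. The matrix norm is the Euclidean operator
  norm. The limes superior is taken in the extended reals, where it needs no boundedness
  side condition.\<close>

definition matrix_product :: "(real^'n^'n) list \<Rightarrow> real^'n^'n" where
  "matrix_product Ls = foldr (**) Ls (mat 1)"

definition joint_spectral_radius :: "(real^'n \<Rightarrow> real^'n) set \<Rightarrow> ereal" where
  "joint_spectral_radius F =
     limsup (\<lambda>k. ereal (root k
       (Max {onorm (\<lambda>x. matrix_product Ls *v x) | Ls.
               length Ls = k \<and> set Ls \<subseteq> linear_part ` F})))"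

definition affine_family ::
    "(nat \<Rightarrow> real^'n \<Rightarrow> real^'n) \<Rightarrow> (nat \<Rightarrow> real^'n) \<Rightarrow> nat \<Rightarrow> real \<Rightarrow> (real^'n \<Rightarrow> real^'n) set" where
  "affine_family f q N t = (\<lambda>i x. t *\<^sub>R f i x + q i) ` {1..N}"

definition hutchinson :: "('a \<Rightarrow> 'a) set \<Rightarrow> 'a set \<Rightarrow> 'a set" where
  "hutchinson F K = (\<Union>f\<in>F. f ` K)"

text \<open>Used below for non-empty compact sets only, where both suprema are attained.\<close>

definition hausdorff_dist :: "'a::metric_space set \<Rightarrow> 'a set \<Rightarrow> real" where
  "hausdorff_dist A B = max (SUP a\<in>A. infdist a B) (SUP b\<in>B. infdist b A)"

definition is_attractor :: "('a::metric_space \<Rightarrow> 'a) set \<Rightarrow> 'a set \<Rightarrow> bool" where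
  "is_attractor F A \<longleftrightarrow> compact A \<and> A \<noteq> {} \<and>
     (\<forall>K. compact K \<and> K \<noteq> {} \<longrightarrow> (\<lambda>k. hausdorff_dist ((hutchinson F ^^ k) K) A) \<longlonglongrightarrow> 0)"

end

theory Submission
  imports Defs
begin

text \<open>
  Write \<open>a k\<close> for the largest norm of a product of \<open>k\<close> linear parts. Both the inequality
  \<open>t < 1 / \<rho>\<close> and the existence of an attractor are equivalent to one condition on a single word
  length: \<open>t ^ n * a n < 1\<close> for some \<open>n \<ge> 1\<close>.

  For the spectral radius this is submultiplicativity, \<open>a (m + n) \<le> a m * a n\<close>: a bound
  \<open>a n \<le> c ^ n\<close> at one length propagates to \<open>a k \<le> B * c ^ k\<close> at all lengths
  (\<open>submultiplicative_geometric_bound\<close>), and the factor \<open>B\<close> disappears under the \<open>k\<close>-th root.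

  If the condition holds, the same propagation makes every composition of \<open>k\<close> maps of the family
  Lipschitz with constant \<open>B * \<theta> ^ k\<close> for some \<open>\<theta> < 1\<close>. The orbit of a point under the Hutchinson
  operator is then a Cauchy sequence of finite sets, whose limit is an intersection of nested
  thickenings and attracts every compact set (\<open>attractor_of_eventually_contracting\<close>).

  Conversely, an attractor \<open>A\<close> attracts a ball whose radius is huge compared to the norms of the
  points of \<open>A\<close>. After some number \<open>n\<close> of steps the whole image of that ball lies near \<open>A\<close>, so each
  composition of \<open>n\<close> maps shrinks the ball by a factor of at least two, which gives
  \<open>t ^ n * a n \<le> 1 / 2\<close> (\<open>attractor_imp_contracting_length\<close>). Since the ball may be chosen this large,
  the bound is strict, and so the critical value \<open>t = 1 / \<rho>\<close> is excluded as well.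
\<close>

section \<open>The Hausdorff distance\<close>

text \<open>
  The lower bound needs an argument because a supremum of reals is unspecified for unbounded sets; it
  is what allows convergence to \<open>0\<close> to be proved by squeezing.
\<close>

lemma hausdorff_dist_bounds:
  assumes "A \<noteq> {}" "B \<noteq> {}"
    and AB: "\<And>a. a \<in> A \<Longrightarrow> \<exists>b\<in>B. dist a b \<le> r"
    and BA: "\<And>b. b \<in> B \<Longrightarrow> \<exists>a\<in>A. dist b a \<le> r"
  shows "0 \<le> hausdorff_dist A B" and "hausdorff_dist A B \<le> r"
proof -
  have A: "infdist a B \<le> r" if "a \<in> A" for a
    using AB[OF that] by (meson infdist_le order_trans)
  have B: "infdist b A \<le> r" if "b \<in> B" for b
    using BA[OF that] by (meson infdist_le order_trans)
  obtain a where a: "a \<in> A" using \<open>A \<noteq> {}\<close> by blast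
  have "bdd_above ((\<lambda>a. infdist a B) ` A)"
    using A by (intro bdd_aboveI2)
  then have "infdist a B \<le> (SUP a\<in>A. infdist a B)"
    using a by (rule cSUP_upper[rotated])
  then show "0 \<le> hausdorff_dist A B"
    using infdist_nonneg[of a B] unfolding hausdorff_dist_def by linarith
  show "hausdorff_dist A B \<le> r"
    using A B assms(1,2) unfolding hausdorff_dist_def by (auto intro!: cSUP_least)
qed

lemma infdist_le_hausdorff_dist:
  assumes "compact A" "a \<in> A"
  shows "infdist a B \<le> hausdorff_dist A B"
proof -
  have "compact ((\<lambda>a. infdist a B) ` A)"
    using assms by (intro compact_continuous_image continuous_intros)
  then have "bdd_above ((\<lambda>a. infdist a B) ` A)"
    by (simp add: bounded_imp_bdd_above compact_imp_bounded)
  then have "infdist a B \<le> (SUP a\<in>A. infdist a B)"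
    using assms(2) by (rule cSUP_upper[rotated])
  then show ?thesis
    unfolding hausdorff_dist_def by (rule max.coboundedI1)
qed

section \<open>Iterates of the Hutchinson operator\<close>

definition word_map :: "('a \<Rightarrow> 'a) list \<Rightarrow> 'a \<Rightarrow> 'a" where
  "word_map ws = foldr (\<circ>) ws id"

lemma word_map_simps [simp]:
  "word_map [] x = x"
  "word_map (g # ws) x = g (word_map ws x)"
  by (simp_all add: word_map_def)

lemma hutchinson_funpow:
  "(hutchinson F ^^ n) K = {word_map ws x | ws x. length ws = n \<and> set ws \<subseteq> F \<and> x \<in> K}"
proof (induction n)
  case 0
  show ?case by auto
next
  case (Suc n)
  show ?case
  proof (intro set_eqI iffI)
    fix y assume "y \<in> (hutchinson F ^^ Suc n) K"
    then obtain g ws x where "g \<in> F" "length ws = n" "set ws \<subseteq> F" "x \<in> K"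
        "y = g (word_map ws x)"
      by (auto simp: Suc hutchinson_def)
    then have "length (g # ws) = Suc n" "set (g # ws) \<subseteq> F" "y = word_map (g # ws) x" "x \<in> K"
      by auto
    then show "y \<in> {word_map ws x | ws x. length ws = Suc n \<and> set ws \<subseteq> F \<and> x \<in> K}"
      by blast
  next
    fix y assume "y \<in> {word_map ws x | ws x. length ws = Suc n \<and> set ws \<subseteq> F \<and> x \<in> K}"
    then obtain g ws x where "g \<in> F" "length ws = n" "set ws \<subseteq> F" "x \<in> K"
        "y = g (word_map ws x)"
      by (auto simp: length_Suc_conv)
    then show "y \<in> (hutchinson F ^^ Suc n) K"
      by (auto simp: Suc hutchinson_def)
  qed
qed

lemma word_map_in_hutchinson_funpow:
  assumes "set ws \<subseteq> F" "x \<in> K"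
  shows "word_map ws x \<in> (hutchinson F ^^ length ws) K"
  using assms by (auto simp: hutchinson_funpow)

lemma hutchinson_funpow_ne:
  assumes "F \<noteq> {}" "K \<noteq> {}"
  shows "(hutchinson F ^^ n) K \<noteq> {}"
  using assms by (induction n) (auto simp: hutchinson_def)

lemma compact_hutchinson_funpow:
  assumes "finite F" "\<And>g. g \<in> F \<Longrightarrow> continuous_on UNIV g" "compact K"
  shows "compact ((hutchinson F ^^ n) K)"
proof (induction n)
  case (Suc n)
  have "compact (g ` (hutchinson F ^^ n) K)" if "g \<in> F" for g
    using assms(2)[OF that] Suc by (meson compact_continuous_image continuous_on_subset top_greatest)
  then have "compact (hutchinson F ((hutchinson F ^^ n) K))"
    unfolding hutchinson_def[of F "(hutchinson F ^^ n) K"] using assms(1) by (intro compact_UN) auto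
  then show ?case by simp
qed (use assms in simp)

text \<open>
  Comparing two starting sets word by word: a word of length \<open>n\<close> moves points at distance at most
  \<open>D\<close> to points at distance at most \<open>B * \<theta> ^ n * D\<close>.
\<close>

lemma hutchinson_funpow_close:
  fixes F :: "('a::metric_space \<Rightarrow> 'a) set"
  assumes lip: "\<And>ws x y. set ws \<subseteq> F \<Longrightarrow>
      dist (word_map ws x) (word_map ws y) \<le> B * \<theta> ^ length ws * dist x y"
    and "0 \<le> B" "0 \<le> \<theta>"
    and KL: "\<And>x. x \<in> K \<Longrightarrow> \<exists>y\<in>L. dist x y \<le> D"
    and u: "u \<in> (hutchinson F ^^ n) K"
  shows "\<exists>v\<in>(hutchinson F ^^ n) L. dist u v \<le> B * \<theta> ^ n * D"
proof -
  obtain ws x where ws: "length ws = n" "set ws \<subseteq> F" "x \<in> K" "u = word_map ws x"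
    using u by (auto simp: hutchinson_funpow)
  obtain y where y: "y \<in> L" "dist x y \<le> D" using KL[OF ws(3)] by blast
  have "dist u (word_map ws y) \<le> B * \<theta> ^ n * dist x y"
    using lip[OF ws(2)] ws by simp
  also have "\<dots> \<le> B * \<theta> ^ n * D"
    using y(2) assms(2,3) by (intro mult_left_mono) auto
  finally show ?thesis
    using word_map_in_hutchinson_funpow[OF ws(2) y(1)] ws(1) by blast
qed

text \<open>
  The sets \<open>P n\<close> reached from a base point after \<open>n\<close> steps satisfy
  \<open>hausdorff_dist (P n) (P (n + 1)) \<le> e n\<close> with \<open>e n\<close> geometric. Thickening \<open>P n\<close> by the tail
  \<open>r n = e n + e (n + 1) + \<dots>\<close> therefore gives nested compact sets, and their intersection is within
  \<open>r n\<close> of \<open>P n\<close> in both directions. In place of completeness of the space of compact sets, only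
  Cantor's intersection theorem is needed.
\<close>

theorem attractor_of_eventually_contracting:
  fixes F :: "('a::heine_borel \<Rightarrow> 'a) set"
  assumes F: "finite F" "F \<noteq> {}"
    and B: "0 \<le> B" and \<theta>: "0 \<le> \<theta>" "\<theta> < 1"
    and lip: "\<And>ws x y. set ws \<subseteq> F \<Longrightarrow>
      dist (word_map ws x) (word_map ws y) \<le> B * \<theta> ^ length ws * dist x y"
  shows "\<exists>A. is_attractor F A"
proof -
  note close = hutchinson_funpow_close[OF lip B \<theta>(1)]
  fix x0 :: 'a
  define P where "P n = (hutchinson F ^^ n) {x0}" for n
  define D where "D = Max ((\<lambda>g. dist (g x0) x0) ` F)"
  define e where "e n = B * \<theta> ^ n * D" for n
  define r where "r n = e n / (1 - \<theta>)" for n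
  define S where "S n = (\<Union>y\<in>P n. cball y (r n))" for n
  have D: "dist (g x0) x0 \<le> D" if "g \<in> F" for g
    using F that by (auto simp: D_def)
  have D0: "0 \<le> D" using F D by (meson all_not_in_conv order_trans zero_le_dist)
  have e0: "0 \<le> e n" for n unfolding e_def using B \<theta> D0 by simp
  have r0: "0 \<le> r n" for n unfolding r_def using e0 \<theta> by simp
  have r_Suc: "r n = e n + r (Suc n)" for n
    using \<theta> by (simp add: r_def e_def field_simps)
  have P_finite: "finite (P n)" for n
    using F(1) by (induction n) (auto simp: P_def hutchinson_def)
  have P_ne: "P n \<noteq> {}" for n unfolding P_def by (rule hutchinson_funpow_ne) (use F in auto)
  have P_Suc: "P (Suc n) = (hutchinson F ^^ n) (hutchinson F {x0})" for n
    unfolding P_def by (simp add: funpow_swap1)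
  have down: "\<exists>y\<in>P n. dist z y \<le> e n" if "z \<in> P (Suc n)" for z n
  proof -
    have "\<exists>y\<in>{x0}. dist x y \<le> D" if "x \<in> hutchinson F {x0}" for x
      using that D by (auto simp: hutchinson_def)
    then show ?thesis
      using that close[where K = "hutchinson F {x0}" and L = "{x0}" and D = D and u = z and n = n]
      unfolding P_Suc by (auto simp: P_def e_def)
  qed
  have up: "\<exists>z\<in>P (Suc n). dist y z \<le> e n" if "y \<in> P n" for y n
  proof -
    have "\<exists>y\<in>hutchinson F {x0}. dist x y \<le> D" if "x \<in> {x0}" for x
      using that D F(2) by (fastforce simp: hutchinson_def dist_commute)
    then show ?thesis
      using that close[where K = "{x0}" and L = "hutchinson F {x0}" and D = D and u = y and n = n]
      unfolding P_Suc by (auto simp: P_def e_def)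
  qed
  have S_compact: "compact (S n)" for n
    unfolding S_def using P_finite by (intro compact_UN) auto
  have S_Suc: "S (Suc n) \<subseteq> S n" for n
  proof
    fix x assume "x \<in> S (Suc n)"
    then obtain z where z: "z \<in> P (Suc n)" "dist z x \<le> r (Suc n)" by (auto simp: S_def)
    obtain y where y: "y \<in> P n" "dist z y \<le> e n" using down[OF z(1)] by blast
    have "dist y x \<le> r n"
      using dist_triangle[of y x z] z(2) y(2) r_Suc[of n] by (simp add: dist_commute)
    then show "x \<in> S n" using y(1) by (auto simp: S_def)
  qed
  have S_anti: "S n \<subseteq> S m" if "m \<le> n" for m n
    using that S_Suc by (rule lift_Suc_antimono_le[rotated])
  define A where "A = (\<Inter>n. S n)"
  have A_near_P: "\<exists>y\<in>P n. dist x y \<le> r n" if "x \<in> A" for x n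
    using that by (fastforce simp: A_def S_def dist_commute)
  have P_near_A: "\<exists>x\<in>A. dist y x \<le> r n" if y: "y \<in> P n" for y n
  proof -
    \<comment> \<open>The walk \<open>y \<in> P n\<close>, \<open>z \<in> P (n + 1)\<close>, \<dots> spends only the part \<open>r n - r (n + m)\<close> of its budget
      in \<open>m\<close> steps, so it stays in \<open>cball y (r n)\<close> for ever.\<close>
    have reach: "\<exists>z\<in>P (n + m). dist y z \<le> r n - r (n + m)" for m
    proof (induction m)
      case 0
      show ?case using y by force
    next
      case (Suc m)
      then obtain z where z: "z \<in> P (n + m)" "dist y z \<le> r n - r (n + m)" by blast
      obtain z' where z': "z' \<in> P (Suc (n + m))" "dist z z' \<le> e (n + m)" using up[OF z(1)] by blast
      have "dist y z' \<le> r n - r (Suc (n + m))"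
        using dist_triangle[of y z' z] z(2) z'(2) r_Suc[of "n + m"] by simp
      then show ?case using z'(1) by auto
    qed
    have "(\<Inter>m. S (n + m) \<inter> cball y (r n)) \<noteq> {}"
    proof (rule compact_nest)
      show "compact (S (n + m) \<inter> cball y (r n))" for m
        using S_compact by (intro compact_Int) auto
      show "S (n + m) \<inter> cball y (r n) \<noteq> {}" for m
      proof -
        obtain z where z: "z \<in> P (n + m)" "dist y z \<le> r n - r (n + m)" using reach by blast
        then have "z \<in> S (n + m) \<inter> cball y (r n)"
          using r0[of "n + m"] by (force simp: S_def)
        then show ?thesis by blast
      qed
      show "S (n + m') \<inter> cball y (r n) \<subseteq> S (n + m) \<inter> cball y (r n)" if "m \<le> m'" for m m'
        using S_anti[of "n + m" "n + m'"] that by auto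
    qed
    then obtain x where "x \<in> (\<Inter>m. S (n + m) \<inter> cball y (r n))" by blast
    then have x: "\<And>m. x \<in> S (n + m)" "dist y x \<le> r n" by auto
    have "x \<in> S m" for m using x(1)[of m] S_anti[of m "n + m"] by auto
    then show ?thesis using x(2) by (auto simp: A_def)
  qed
  have A_ne: "A \<noteq> {}" using P_near_A P_ne by blast
  have A_compact: "compact A"
    unfolding A_def using S_compact by (intro compact_Inter) auto
  have "(\<lambda>n. hausdorff_dist ((hutchinson F ^^ n) K) A) \<longlonglongrightarrow> 0"
    if K: "compact K" "K \<noteq> {}" for K
  proof -
    obtain d where d: "\<And>x. x \<in> K \<Longrightarrow> dist x0 x \<le> d"
      using compact_imp_bounded[OF K(1)] by (auto simp: bounded_any_center[of _ x0])
    define s where "s n = B * \<theta> ^ n * d + r n" for n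
    have KA: "\<exists>a\<in>A. dist x a \<le> s n" if x: "x \<in> (hutchinson F ^^ n) K" for x n
    proof -
      have "\<exists>y\<in>{x0}. dist x y \<le> d" if "x \<in> K" for x
        using d[OF that] by (simp add: dist_commute)
      then obtain y where y: "y \<in> P n" "dist x y \<le> B * \<theta> ^ n * d"
        using close[where K = K and L = "{x0}" and D = d and u = x and n = n] x unfolding P_def by blast
      obtain a where a: "a \<in> A" "dist y a \<le> r n" using P_near_A[OF y(1)] by blast
      then show ?thesis
        using y(2) dist_triangle[of x a y] unfolding s_def by (intro bexI[of _ a]) auto
    qed
    have AK: "\<exists>x\<in>(hutchinson F ^^ n) K. dist a x \<le> s n" if a: "a \<in> A" for a n
    proof -
      obtain y where y: "y \<in> P n" "dist a y \<le> r n" using A_near_P[OF a] by blast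
      have "\<exists>y\<in>K. dist x y \<le> d" if "x \<in> {x0}" for x
        using d K(2) that by blast
      then obtain x where x: "x \<in> (hutchinson F ^^ n) K" "dist y x \<le> B * \<theta> ^ n * d"
        using close[where K = "{x0}" and L = K and D = d and u = y and n = n] y(1) unfolding P_def by blast
      then show ?thesis
        using y(2) dist_triangle[of a x y] unfolding s_def by (intro bexI[of _ x]) auto
    qed
    note bounds = hausdorff_dist_bounds[OF hutchinson_funpow_ne[OF F(2) K(2)] A_ne KA AK]
    have "(\<lambda>n. \<theta> ^ n) \<longlonglongrightarrow> 0" using \<theta> by (intro LIMSEQ_realpow_zero) auto
    then have "(\<lambda>n. \<theta> ^ n * (B * d + B * D / (1 - \<theta>))) \<longlonglongrightarrow> 0"
      by (rule tendsto_mult_left_zero)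
    moreover have "s = (\<lambda>n. \<theta> ^ n * (B * d + B * D / (1 - \<theta>)))"
      by (auto simp: s_def r_def e_def algebra_simps)
    ultimately have "s \<longlonglongrightarrow> 0" by simp
    then show ?thesis
      by (rule tendsto_sandwich[rotated 3]) (use bounds in auto)
  qed
  then show ?thesis
    using A_compact A_ne unfolding is_attractor_def by blast
qed

section \<open>Norms of matrix words and the joint spectral radius\<close>

definition max_word_norm :: "(real^'n^'n) set \<Rightarrow> nat \<Rightarrow> real" where
  "max_word_norm S k = Max {onorm (\<lambda>x. matrix_product Ls *v x) | Ls. length Ls = k \<and> set Ls \<subseteq> S}"

lemma matrix_product_simps [simp]:
  "matrix_product [] = mat 1"
  "matrix_product (L # Ls) = L ** matrix_product Ls"
  by (simp_all add: matrix_product_def)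

lemma matrix_product_append:
  "matrix_product (Ls @ Ms) = matrix_product Ls ** matrix_product Ms"
  by (induction Ls) (simp_all add: matrix_mul_assoc)

lemma word_norms_finite_ne:
  fixes S :: "(real^'n^'n) set"
  assumes "finite S"
  shows "finite {onorm (\<lambda>x. matrix_product Ls *v x) | Ls. length Ls = k \<and> set Ls \<subseteq> S}" (is "finite ?A")
    and "S \<noteq> {} \<Longrightarrow>
      {onorm (\<lambda>x. matrix_product Ls *v x) | Ls. length Ls = k \<and> set Ls \<subseteq> S} \<noteq> {}"
proof -
  have "?A = (\<lambda>Ls. onorm (\<lambda>x. matrix_product Ls *v x)) ` {Ls. set Ls \<subseteq> S \<and> length Ls = k}"
    by auto
  then show "finite ?A" using finite_lists_length_eq[OF assms(1)] by simp
  assume "S \<noteq> {}"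
  then obtain L where "L \<in> S" by blast
  then have "length (replicate k L) = k" "set (replicate k L) \<subseteq> S" by auto
  then show "?A \<noteq> {}" by blast
qed

lemma norm_le_max_word_norm:
  assumes "finite S" "set Ls \<subseteq> S"
  shows "onorm (\<lambda>x. matrix_product Ls *v x) \<le> max_word_norm S (length Ls)"
  unfolding max_word_norm_def using assms word_norms_finite_ne(1) by (intro Max_ge) auto

lemma max_word_norm_le:
  assumes "finite S" "S \<noteq> {}"
    and "\<And>Ls. length Ls = k \<Longrightarrow> set Ls \<subseteq> S \<Longrightarrow> onorm (\<lambda>x. matrix_product Ls *v x) \<le> b"
  shows "max_word_norm S k \<le> b"
  unfolding max_word_norm_def using word_norms_finite_ne[OF assms(1)] assms(2,3)
  by (subst Max_le_iff) auto

lemma max_word_norm_nonneg: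
  assumes "finite S" "S \<noteq> {}"
  shows "0 \<le> max_word_norm S k"
proof -
  obtain L where "L \<in> S" using assms(2) by blast
  then have "0 \<le> onorm (\<lambda>x. matrix_product (replicate k L) *v x)"
    by (intro onorm_pos_le matrix_vector_mul_bounded_linear)
  also have "\<dots> \<le> max_word_norm S k"
    using norm_le_max_word_norm[OF assms(1), of "replicate k L"] \<open>L \<in> S\<close>
    by (simp add: set_replicate_conv_if)
  finally show ?thesis .
qed

lemma max_word_norm_submult:
  assumes "finite S" "S \<noteq> {}"
  shows "max_word_norm S (m + n) \<le> max_word_norm S m * max_word_norm S n"
proof (rule max_word_norm_le[OF assms])
  fix Ls assume Ls: "length Ls = m + n" "set Ls \<subseteq> S"
  let ?U = "take m Ls" and ?V = "drop m Ls"
  have len: "length ?U = m" "length ?V = n" and sub: "set ?U \<subseteq> S" "set ?V \<subseteq> S"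
    using Ls set_take_subset[of m Ls] set_drop_subset[of m Ls] by auto
  have "(\<lambda>x. matrix_product Ls *v x)
      = (\<lambda>x. matrix_product ?U *v x) \<circ> (\<lambda>x. matrix_product ?V *v x)"
    using matrix_product_append[of ?U ?V] by (simp add: fun_eq_iff matrix_vector_mul_assoc)
  then have "onorm (\<lambda>x. matrix_product Ls *v x)
      \<le> onorm (\<lambda>x. matrix_product ?U *v x) * onorm (\<lambda>x. matrix_product ?V *v x)"
    using onorm_compose[OF matrix_vector_mul_bounded_linear matrix_vector_mul_bounded_linear] by metis
  also have "\<dots> \<le> max_word_norm S m * max_word_norm S n"
    using norm_le_max_word_norm[OF assms(1) sub(1)] norm_le_max_word_norm[OF assms(1) sub(2)] len
    by (intro mult_mono onorm_pos_le matrix_vector_mul_bounded_linear max_word_norm_nonneg assms) auto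
  finally show "onorm (\<lambda>x. matrix_product Ls *v x) \<le> max_word_norm S m * max_word_norm S n" .
qed

text \<open>
  Splitting \<open>k = n * j + i\<close> with \<open>i < n\<close> costs a factor that depends only on the finitely many
  remainders \<open>i\<close>.
\<close>

lemma submultiplicative_geometric_bound:
  fixes a :: "nat \<Rightarrow> real"
  assumes sub: "\<And>m n. a (m + n) \<le> a m * a n" and nonneg: "\<And>n. 0 \<le> a n"
    and n: "1 \<le> n" and c: "0 < c" and an: "a n \<le> c ^ n"
  shows "\<exists>B>0. \<forall>k. a k \<le> B * c ^ k"
proof -
  define B where "B = 1 + (\<Sum>i<n. a i / c ^ i)"
  have sum0: "0 \<le> (\<Sum>i<n. a i / c ^ i)" using nonneg c by (intro sum_nonneg) auto
  have small: "a i \<le> B * c ^ i" if "i < n" for i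
  proof -
    have "a i / c ^ i \<le> (\<Sum>i<n. a i / c ^ i)"
      using that nonneg c by (intro member_le_sum) auto
    then have "a i / c ^ i \<le> B" by (simp add: B_def)
    then show ?thesis using c by (simp add: field_simps)
  qed
  have "a k \<le> B * c ^ k" for k
  proof (induction k rule: less_induct)
    case (less k)
    show ?case
    proof (cases "k < n")
      case False
      then have "a k \<le> a n * a (k - n)" using sub[of n "k - n"] by simp
      also have "\<dots> \<le> c ^ n * (B * c ^ (k - n))"
        using an less[of "k - n"] n False nonneg c by (intro mult_mono) auto
      also have "\<dots> = B * c ^ k" using False by (simp flip: power_add)
      finally show ?thesis .
    qed (use small in auto)
  qed
  moreover have "0 < B" using sum0 by (simp add: B_def)
  ultimately show ?thesis by blast
qed

text \<open>
  The strict inequality leaves room between \<open>root n b\<close> and \<open>1 / t\<close> for a rate \<open>c\<close> that is positive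
  even if \<open>b = 0\<close>, as division by powers of \<open>c\<close> requires.
\<close>

lemma contracting_length_rate:
  fixes b t :: real
  assumes "0 \<le> t" "1 \<le> n" "0 \<le> b" "t ^ n * b < 1"
  shows "\<exists>c>0. b \<le> c ^ n \<and> t * c < 1"
proof (cases "t = 0")
  case True
  have "b \<le> (1 + root n b) ^ n"
    using assms power_mono[of "root n b" "1 + root n b" n] by (simp add: real_root_pow_pos2)
  moreover have "0 < 1 + root n b" using assms by (simp add: add_pos_nonneg)
  ultimately show ?thesis using True by (intro exI[of _ "1 + root n b"]) auto
next
  case False
  then have t: "0 < t" using assms by simp
  have "b < (1 / t) ^ n" using assms t by (simp add: field_simps)
  then have "root n b < root n ((1 / t) ^ n)" using assms by (intro real_root_less_mono) auto
  then have "root n b < 1 / t" using assms t by (simp add: real_root_power_cancel)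
  then obtain c where c: "root n b < c" "c < 1 / t" using dense by blast
  have c0: "0 \<le> root n b" using assms by simp
  have "b = root n b ^ n" using assms by (simp add: real_root_pow_pos2)
  also have "\<dots> \<le> c ^ n" using c c0 by (intro power_mono) auto
  finally show ?thesis using c c0 t by (intro exI[of _ c]) (auto simp: field_simps)
qed

text \<open>
  If one length contracts, then \<open>\<rho> \<le> c\<close> for some \<open>c\<close> with \<open>t * c < 1\<close>. If \<open>\<rho> < 1 / t\<close>, then by
  definition of the limes superior all large lengths contract. The value \<open>t = 0\<close>, where \<open>1 / t\<close> is
  meaningless, satisfies both sides.
\<close>

lemma less_inverse_joint_spectral_radius_iff:
  fixes F :: "(real^'n \<Rightarrow> real^'n) set"
  assumes F: "finite F" "F \<noteq> {}" and t: "0 \<le> t"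
  shows "ereal t < 1 / joint_spectral_radius F \<longleftrightarrow>
    (\<exists>n\<ge>1. t ^ n * max_word_norm (linear_part ` F) n < 1)"
proof -
  define a where "a = max_word_norm (linear_part ` F)"
  define \<rho> where "\<rho> = joint_spectral_radius F"
  have S: "finite (linear_part ` F)" "linear_part ` F \<noteq> {}" using F by auto
  have nonneg: "0 \<le> a n" for n unfolding a_def by (rule max_word_norm_nonneg[OF S])
  have sub: "a (m + n) \<le> a m * a n" for m n unfolding a_def by (rule max_word_norm_submult[OF S])
  have \<rho>: "\<rho> = limsup (\<lambda>k. ereal (root k (a k)))"
    by (simp add: \<rho>_def joint_spectral_radius_def a_def max_word_norm_def)
  have \<rho>0: "0 \<le> \<rho>"
    unfolding \<rho> by (rule le_Limsup) (auto simp: nonneg intro!: always_eventually real_root_ge_zero)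
  have upper: "\<rho> \<le> ereal c" if c: "0 < c" and n: "1 \<le> n" "a n \<le> c ^ n" for c n
  proof -
    obtain B where B: "0 < B" "\<And>k. a k \<le> B * c ^ k"
      using submultiplicative_geometric_bound[OF sub nonneg n(1) c n(2)] by blast
    have "\<forall>\<^sub>F k in sequentially. ereal (root k (a k)) \<le> ereal (root k B * c)"
      using eventually_gt_at_top[of 0]
    proof eventually_elim
      case (elim k)
      have "root k (a k) \<le> root k (B * c ^ k)" using elim B by simp
      then show ?case using elim c by (simp add: real_root_mult real_root_power_cancel)
    qed
    then have "\<rho> \<le> limsup (\<lambda>k. ereal (root k B * c))" unfolding \<rho> by (rule Limsup_mono)
    moreover have "(\<lambda>k. ereal (root k B * c)) \<longlonglongrightarrow> ereal (1 * c)"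
      using B(1) by (intro tendsto_intros LIMSEQ_root_const)
    ultimately show ?thesis by (simp add: lim_imp_Limsup)
  qed
  have "ereal t < 1 / \<rho> \<longleftrightarrow> (\<exists>n\<ge>1. t ^ n * a n < 1)"
  proof
    assume lt: "ereal t < 1 / \<rho>"
    show "\<exists>n\<ge>1. t ^ n * a n < 1"
    proof (cases "t = 0")
      case False
      then have t: "0 < t" using t by simp
      have "\<rho> < ereal (1 / t)"
        using lt \<rho>0 t by (cases \<rho>) (auto simp: field_simps one_ereal_def divide_ereal_def split: if_splits)
      then have "\<forall>\<^sub>F k in sequentially. ereal (root k (a k)) < ereal (1 / t)"
        unfolding \<rho> by (rule Limsup_lessD)
      then have "\<forall>\<^sub>F k in sequentially. ereal (root k (a k)) < ereal (1 / t) \<and> 1 \<le> k"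
        using eventually_ge_at_top[of 1] by (rule eventually_conj)
      then obtain k where k: "root k (a k) < 1 / t" "1 \<le> k"
        by (auto dest: eventually_happens)
      have "a k = root k (a k) ^ k" using k(2) nonneg by (simp add: real_root_pow_pos2)
      also have "\<dots> < (1 / t) ^ k" using k nonneg by (intro power_strict_mono) auto
      finally have "t ^ k * a k < 1" using t by (simp add: field_simps)
      then show ?thesis using k(2) by blast
    qed (auto intro!: exI[of _ 1])
  next
    assume "\<exists>n\<ge>1. t ^ n * a n < 1"
    then obtain n where n: "1 \<le> n" "t ^ n * a n < 1" by blast
    obtain c where c: "0 < c" "a n \<le> c ^ n" "t * c < 1"
      using contracting_length_rate[OF t n(1) nonneg n(2)] by blast
    have le: "\<rho> \<le> ereal c" using upper c n by blast
    show "ereal t < 1 / \<rho>"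
    proof (cases \<rho>)
      case (real x)
      then have x: "0 \<le> x" "x \<le> c" using le \<rho>0 by auto
      have "t * x < 1" using mult_left_mono[OF x(2) t] c(3) by simp
      then show ?thesis using real x
        by (cases "x = 0") (auto simp: field_simps one_ereal_def divide_ereal_def)
    qed (use le \<rho>0 in auto)
  qed
  then show ?thesis by (simp add: a_def \<rho>_def)
qed

section \<open>Words of an affine family\<close>

text \<open>
  The translation parts cancel in differences, so a word of affine maps acts on differences by the
  corresponding word of linear parts, with one factor \<open>t\<close> for each letter. Both directions of the
  correspondence are used: the existence of an attractor needs a bound for every word of maps, and
  its converse a bound for every word of matrices.
\<close>

lemma affine_function_diff:
  assumes "affine_function g"
  shows "g x - g y = linear_part g *v (x - y)"
proof -
  obtain L a where L: "\<And>x. g x = L *v x + a" using assms by (auto simp: affine_function_def)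
  then have "linear_part g = L" by (rule linear_part_eq)
  then show ?thesis by (simp add: L matrix_vector_mult_diff_distrib)
qed

context
  fixes f :: "nat \<Rightarrow> real^'n \<Rightarrow> real^'n" and q :: "nat \<Rightarrow> real^'n" and N :: nat and t :: real
  assumes affine: "\<And>i. i \<in> {1..N} \<Longrightarrow> affine_function (f i)"
begin

lemma affine_family_letter_diff:
  assumes "i \<in> {1..N}"
  shows "(t *\<^sub>R f i x + q i) - (t *\<^sub>R f i y + q i) = t *\<^sub>R (linear_part (f i) *v (x - y))"
  using affine_function_diff[OF affine[OF assms], of x y] by (simp flip: scaleR_diff_right)

lemma affine_family_word_diff:
  assumes "set ws \<subseteq> affine_family f q N t"
  shows "\<exists>Ls. length Ls = length ws \<and> set Ls \<subseteq> linear_part ` f ` {1..N} \<and>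
    (\<forall>x y. word_map ws x - word_map ws y = t ^ length ws *\<^sub>R (matrix_product Ls *v (x - y)))"
  using assms
proof (induction ws)
  case Nil
  show ?case by simp
next
  case (Cons g ws)
  then obtain Ls where Ls: "length Ls = length ws" "set Ls \<subseteq> linear_part ` f ` {1..N}"
      "\<And>x y. word_map ws x - word_map ws y = t ^ length ws *\<^sub>R (matrix_product Ls *v (x - y))"
    by auto
  obtain i where i: "i \<in> {1..N}" "g = (\<lambda>x. t *\<^sub>R f i x + q i)"
    using Cons.prems by (auto simp: affine_family_def)
  have "word_map (g # ws) x - word_map (g # ws) y
      = t ^ length (g # ws) *\<^sub>R (matrix_product (linear_part (f i) # Ls) *v (x - y))" for x y
    using affine_family_letter_diff[OF i(1)]
    by (simp add: i(2) Ls(3) matrix_vector_mult_scaleR matrix_vector_mul_assoc)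
  then show ?case
    using Ls(1,2) i(1) by (intro exI[of _ "linear_part (f i) # Ls"]) auto
qed

lemma matrix_word_from_affine_family:
  assumes "set Ls \<subseteq> linear_part ` f ` {1..N}"
  shows "\<exists>ws. length ws = length Ls \<and> set ws \<subseteq> affine_family f q N t \<and>
    (\<forall>x y. word_map ws x - word_map ws y = t ^ length Ls *\<^sub>R (matrix_product Ls *v (x - y)))"
  using assms
proof (induction Ls)
  case Nil
  show ?case by simp
next
  case (Cons L Ls)
  then obtain ws where ws: "length ws = length Ls" "set ws \<subseteq> affine_family f q N t"
      "\<And>x y. word_map ws x - word_map ws y = t ^ length Ls *\<^sub>R (matrix_product Ls *v (x - y))"
    by auto
  obtain i where i: "i \<in> {1..N}" "L = linear_part (f i)"
    using Cons.prems by auto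
  let ?g = "\<lambda>x. t *\<^sub>R f i x + q i"
  have "word_map (?g # ws) x - word_map (?g # ws) y
      = t ^ length (L # Ls) *\<^sub>R (matrix_product (L # Ls) *v (x - y))" for x y
    using affine_family_letter_diff[OF i(1)]
    by (simp add: i(2) ws(3) matrix_vector_mult_scaleR matrix_vector_mul_assoc)
  moreover have "?g \<in> affine_family f q N t" using i(1) by (auto simp: affine_family_def)
  ultimately show ?case
    using ws(1,2) by (intro exI[of _ "?g # ws"]) auto
qed

lemma continuous_affine_family:
  assumes "g \<in> affine_family f q N t"
  shows "continuous_on UNIV g"
proof -
  obtain i where i: "i \<in> {1..N}" "g = (\<lambda>x. t *\<^sub>R f i x + q i)"
    using assms by (auto simp: affine_family_def)
  obtain L a where "\<And>x. f i x = L *v x + a"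
    using affine[OF i(1)] by (auto simp: affine_function_def)
  then have "g = (\<lambda>x. t *\<^sub>R (L *v x + a) + q i)" using i(2) by simp
  then show ?thesis by (auto intro!: continuous_intros)
qed

section \<open>Attractors and contracting word lengths\<close>

lemma contracting_length_imp_attractor:
  assumes N: "1 \<le> N" and t: "0 \<le> t" and n: "1 \<le> n"
    and contr: "t ^ n * max_word_norm (linear_part ` f ` {1..N}) n < 1"
  shows "\<exists>A. is_attractor (affine_family f q N t) A"
proof -
  define a where "a = max_word_norm (linear_part ` f ` {1..N})"
  have S: "finite (linear_part ` f ` {1..N})" "linear_part ` f ` {1..N} \<noteq> {}" using N by auto
  have nonneg: "0 \<le> a k" for k unfolding a_def by (rule max_word_norm_nonneg[OF S])
  have sub: "a (m + k) \<le> a m * a k" for m k unfolding a_def by (rule max_word_norm_submult[OF S])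
  obtain c where c: "0 < c" "a n \<le> c ^ n" "t * c < 1"
    using contracting_length_rate[OF t n nonneg] contr a_def by blast
  obtain B where B: "0 < B" "\<And>k. a k \<le> B * c ^ k"
    using submultiplicative_geometric_bound[OF sub nonneg n c(1,2)] by blast
  show ?thesis
  proof (rule attractor_of_eventually_contracting[where B = B and \<theta> = "t * c"])
    show "finite (affine_family f q N t)" "affine_family f q N t \<noteq> {}"
      using N by (auto simp: affine_family_def)
    show "0 \<le> B" "0 \<le> t * c" "t * c < 1" using B c t by auto
    fix ws x y
    assume "set ws \<subseteq> affine_family f q N t"
    then obtain Ls where Ls: "length Ls = length ws" "set Ls \<subseteq> linear_part ` f ` {1..N}"
        "word_map ws x - word_map ws y = t ^ length ws *\<^sub>R (matrix_product Ls *v (x - y))"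
      using affine_family_word_diff by blast
    have "norm (matrix_product Ls *v (x - y))
        \<le> onorm (\<lambda>x. matrix_product Ls *v x) * norm (x - y)"
      by (intro onorm matrix_vector_mul_bounded_linear)
    also have "\<dots> \<le> B * c ^ length ws * norm (x - y)"
      using norm_le_max_word_norm[OF S(1) Ls(2)] B(2)[of "length ws"] Ls(1)
      by (intro mult_right_mono) (auto simp: a_def)
    finally have "t ^ length ws * norm (matrix_product Ls *v (x - y))
        \<le> t ^ length ws * (B * c ^ length ws * norm (x - y))"
      using t by (intro mult_left_mono) auto
    then show "dist (word_map ws x) (word_map ws y) \<le> B * (t * c) ^ length ws * dist x y"
      using t by (simp add: dist_norm Ls(3) power_mult_distrib mult_ac)
  qed
qed

text \<open>
  Let \<open>A\<close> lie in the ball of radius \<open>d\<close> about the origin. Once the image of the ball of radius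
  \<open>4 * (d + 1)\<close> is within distance \<open>1\<close> of \<open>A\<close>, any two image points under one word are at most
  \<open>2 * (d + 1)\<close> apart, half of that radius.
\<close>

lemma attractor_imp_contracting_length:
  assumes N: "1 \<le> N" and t: "0 \<le> t"
    and attr: "is_attractor (affine_family f q N t) A"
  shows "\<exists>n\<ge>1. t ^ n * max_word_norm (linear_part ` f ` {1..N}) n < 1"
proof -
  let ?H = "hutchinson (affine_family f q N t)"
  have S: "finite (linear_part ` f ` {1..N})" "linear_part ` f ` {1..N} \<noteq> {}" using N by auto
  have A: "compact A" "A \<noteq> {}" using attr by (auto simp: is_attractor_def)
  obtain d where d: "0 < d" "\<And>x. x \<in> A \<Longrightarrow> norm x \<le> d"
    using compact_imp_bounded[OF A(1)] by (auto simp: bounded_pos)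
  define R where "R = 4 * (d + 1)"
  define K :: "(real^'n) set" where "K = cball 0 R"
  have R: "0 < R" using d by (simp add: R_def)
  have K: "compact K" "K \<noteq> {}" using R by (auto simp: K_def)
  have "(\<lambda>k. hausdorff_dist ((?H ^^ k) K) A) \<longlonglongrightarrow> 0"
    using attr K by (simp add: is_attractor_def)
  then have "\<forall>\<^sub>F k in sequentially. hausdorff_dist ((?H ^^ k) K) A < 1"
    by (rule order_tendstoD) simp
  then have "\<forall>\<^sub>F k in sequentially. hausdorff_dist ((?H ^^ k) K) A < 1 \<and> 1 \<le> k"
    using eventually_ge_at_top[of 1] by (rule eventually_conj)
  then obtain n where n: "hausdorff_dist ((?H ^^ n) K) A < 1" "1 \<le> n"
    by (auto dest: eventually_happens)
  have image_bound: "norm y \<le> d + 1" if "y \<in> (?H ^^ n) K" for y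
  proof -
    have "compact ((?H ^^ n) K)"
      using K(1) continuous_affine_family
      by (intro compact_hutchinson_funpow) (auto simp: affine_family_def)
    then have "infdist y A < 1" using infdist_le_hausdorff_dist[OF _ that, of A] n(1) by simp
    moreover obtain z where "z \<in> A" "infdist y A = dist y z"
      using infdist_attains_inf[OF compact_imp_closed[OF A(1)] A(2)] by blast
    ultimately show ?thesis
      using d(2)[of z] norm_triangle_sub[of y z] by (simp add: dist_norm)
  qed
  have word_bound: "t ^ n * onorm (\<lambda>x. matrix_product Ls *v x) \<le> 1 / 2"
    if Ls: "length Ls = n" "set Ls \<subseteq> linear_part ` f ` {1..N}" for Ls
  proof -
    obtain ws where ws: "length ws = n" "set ws \<subseteq> affine_family f q N t"
        "\<And>x y. word_map ws x - word_map ws y = t ^ n *\<^sub>R (matrix_product Ls *v (x - y))"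
      using matrix_word_from_affine_family[OF Ls(2)] Ls(1) by auto
    have ball: "norm (t ^ n *\<^sub>R (matrix_product Ls *v x)) \<le> 2 * (d + 1)" if "norm x \<le> R" for x
    proof -
      have "word_map ws x \<in> (?H ^^ n) K" "word_map ws 0 \<in> (?H ^^ n) K"
        using word_map_in_hutchinson_funpow[OF ws(2), of _ K] ws(1) that R by (auto simp: K_def)
      then have "norm (word_map ws x) \<le> d + 1" "norm (word_map ws 0) \<le> d + 1"
        using image_bound by auto
      then show ?thesis
        using ws(3)[of x 0] norm_triangle_ineq4[of "word_map ws x" "word_map ws 0"] by simp
    qed
    have "norm (t ^ n *\<^sub>R (matrix_product Ls *v x)) \<le> 1 / 2 * norm x" for x
    proof (cases "x = 0")
      case False
      let ?x = "(R / norm x) *\<^sub>R x"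
      have "norm ?x \<le> R" using False R by simp
      from ball[OF this] have "R / norm x * norm (t ^ n *\<^sub>R (matrix_product Ls *v x)) \<le> R / 2"
        using R t by (simp add: matrix_vector_mult_scaleR R_def mult_ac)
      then show ?thesis using False R by (simp add: field_simps)
    qed simp
    then have "onorm (\<lambda>x. t ^ n *\<^sub>R (matrix_product Ls *v x)) \<le> 1 / 2"
      by (intro onorm_le)
    then show ?thesis
      using t by (simp add: onorm_scaleR[OF matrix_vector_mul_bounded_linear])
  qed
  have "t ^ n * max_word_norm (linear_part ` f ` {1..N}) n < 1"
  proof (cases "t = 0")
    case False
    then have t: "0 < t" using t by simp
    have "max_word_norm (linear_part ` f ` {1..N}) n \<le> 1 / 2 / t ^ n"
      using word_bound t by (intro max_word_norm_le[OF S]) (simp add: field_simps)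
    then show ?thesis using t by (simp add: field_simps)
  qed (use n in \<open>simp add: zero_power\<close>)
  then show ?thesis using n(2) by blast
qed

end

theorem corollary4p1:
  fixes f :: "nat \<Rightarrow> real^'n \<Rightarrow> real^'n" and q :: "nat \<Rightarrow> real^'n" and N :: nat and t :: real
  assumes "2 \<le> N"
    and "\<And>i. i \<in> {1..N} \<Longrightarrow> affine_function (f i)"
    and "0 \<le> t"
  shows "(ereal t < 1 / joint_spectral_radius (f ` {1..N})
            \<longrightarrow> (\<exists>A. is_attractor (affine_family f q N t) A)) \<and>
         (ereal t \<ge> 1 / joint_spectral_radius (f ` {1..N})
            \<longrightarrow> \<not> (\<exists>A. is_attractor (affine_family f q N t) A))"
proof -
  have N: "1 \<le> N" and F: "finite (f ` {1..N})" "f ` {1..N} \<noteq> {}" using assms(1) by auto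
  have "(\<exists>A. is_attractor (affine_family f q N t) A)
      \<longleftrightarrow> (\<exists>n\<ge>1. t ^ n * max_word_norm (linear_part ` f ` {1..N}) n < 1)"
    using contracting_length_imp_attractor[of N f t _ q, OF assms(2) N assms(3)]
      attractor_imp_contracting_length[of N f t q, OF assms(2) N assms(3)] by blast
  then show ?thesis
    using less_inverse_joint_spectral_radius_iff[OF F assms(3)] by (simp add: not_less[symmetric])
qed

end
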